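(* Let $l\in\mathbb{N}$ and $n\in\mathbb{N}_0$. Then for all $t>0$, $$|\delta_{right}^lG(t,n)|\le\frac{C_l}{t^{l/2}}\sum_{u=0}^{[l/2]}\left(\frac{(n+1/2)^2}{t}\right)^{l/2-u}G(t,n+l-2u)+C_l\,G(t,n)\sum_{u=[l/2]+1}^{l-1}\frac{1}{t^u},$$ where $C_l$ is a positive constant independent of $t$ and $n$.
   Context: $G(t,n)=e^{-2t}I_n(2t)$ for $t>0$, $n\in\mathbb{Z}$, is the discrete heat kernel, where $I_n(t)=\sum_{m=0}^\infty\frac{1}{m!\,\Gamma(m+n+1)}(t/2)^{2m+n}$ for $n\in\mathbb{N}_0$ and $I_{-n}=I_n$. $\delta_{right}f(n)=f(n)-f(n+1)$ acts in the variable $n$, $\delta_{right}^l$ is its $l$-th iterate, $[\cdot]$ is the integer part, and an empty sum is $0$. *)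

theory Defs
  imports "HOL-Analysis.Analysis"
begin

definition bessel_I_nat :: "nat \<Rightarrow> real \<Rightarrow> real" where
  "bessel_I_nat n t = (\<Sum>m. 1 / (fact m * Gamma (real m + real n + 1)) * (t / 2) ^ (2 * m + n))"

(* The convention I_{-n} = I_n is built in. *)
definition bessel_I :: "int \<Rightarrow> real \<Rightarrow> real" where
  "bessel_I n t = bessel_I_nat (nat \<bar>n\<bar>) t"

definition heat_G :: "real \<Rightarrow> int \<Rightarrow> real" where
  "heat_G t n = exp (- 2 * t) * bessel_I n (2 * t)"

definition delta_right :: "(int \<Rightarrow> real) \<Rightarrow> int \<Rightarrow> real" where
  "delta_right f n = f n - f (n + 1)"

end

theory Submission
  imports Defs
begin

text \<open>
  With \<open>z = 2t\<close>, Poisson's integral writes \<open>I\<^sub>n(z)\<close> as a constant \<open>K(n)\<close> times the integral of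
  \<open>exp (z * cos x) * sin x ^ (2n)\<close> over \<open>[0, pi]\<close>. Inserting the factor \<open>(1 - cos x) ^ i\<close> yields
  moments \<open>M(n,i)\<close> with \<open>M(n,0) = I\<^sub>n(z)\<close>, and a single integration by parts gives the identity
  (\<open>poisson_moment_diff\<close>)
    \<open>M(n,i) - M(n+1,i) = M(n,i+1) - (i/z) * M(n+1,i-1)\<close>.
  Its coefficients do not depend on \<open>n\<close>, so it can be iterated. Give \<open>M(n,i) / z^j\<close> the weight
  \<open>i + 2j\<close>: each difference raises the weight by exactly one. Hence the \<open>l\<close>-th difference of
  \<open>M(n,0)\<close> is bounded by a constant times the sum of \<open>M(n,l-2j) / z^j\<close> over \<open>j \<le> l/2\<close>
  (\<open>ndelta_funpow_moment_le\<close>).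

  The same integration by parts shows that a factor \<open>1 - cos x\<close> costs at most a constant times
  \<open>(2n+1)/z = (n+1/2)/t\<close> if the order of the Bessel function is raised by one as well
  (\<open>poisson_moment_trade\<close>). Therefore \<open>M(n,l-2j)\<close> is at most a constant times
  \<open>((n+1/2)/t)^(l-2j) * I\<^sub>m(z)\<close> with \<open>m = n+l-2j\<close>, and after multiplication by \<open>exp (-2t)\<close> the
  term with index \<open>j\<close> is the summand \<open>u = j\<close> of the first sum in the claim; the second sum is
  nonnegative. All estimates are uniform in \<open>n \<ge> 0\<close> and \<open>t > 0\<close>.
\<close>

section \<open>Poisson moments\<close>

text \<open>
  The constant \<open>(2z)^n n! / (\<pi> (2n)!)\<close> is \<open>z^n / (\<pi> (2n-1)!!)\<close>, the constant of Poisson's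
  integral for \<open>I\<^sub>n(z)\<close>. The parametrisation by an angle, instead of \<open>s = - cos x\<close> in \<open>[-1,1]\<close>, keeps
  the integrand smooth also for \<open>n = 0\<close>, where the weight \<open>(1 - s\<^sup>2)^(n - 1/2)\<close> is unbounded.
\<close>

definition poisson_moment :: "real \<Rightarrow> nat \<Rightarrow> nat \<Rightarrow> real" where
  "poisson_moment z n i = (2 * z) ^ n * fact n / (pi * fact (2 * n)) *
     integral {0..pi} (\<lambda>x. exp (z * cos x) * (1 - cos x) ^ i * sin x ^ (2 * n))"

lemma poisson_moment_nonneg:
  assumes "z > 0"
  shows "poisson_moment z n i \<ge> 0"
proof -
  have "integral {0..pi} (\<lambda>x. exp (z * cos x) * (1 - cos x) ^ i * sin x ^ (2 * n)) \<ge> 0"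
    by (intro integral_nonneg integrable_continuous_real continuous_intros mult_nonneg_nonneg)
       (auto simp: power_mult)
  then show ?thesis
    using assms unfolding poisson_moment_def by (intro mult_nonneg_nonneg divide_nonneg_nonneg) auto
qed

lemma poisson_constant_Suc:
  "(2 * z) ^ Suc n * fact (Suc n) / (pi * fact (2 * Suc n)) =
    z / (2 * real n + 1) * ((2 * z) ^ n * fact n / (pi * fact (2 * n)))"
proof -
  have cancel: "2 * z * p * (b * f) / (pi * (2 * b * c * g)) = z / c * (p * f / (pi * g))"
    if "b > 0" "c > 0" "g > 0" for b c f g p :: real
    using that by (simp add: field_simps)
  have "fact (2 * Suc n) = 2 * (real n + 1) * (2 * real n + 1) * fact (2 * n)"
    by (simp add: algebra_simps)
  moreover have "fact (Suc n) = (real n + 1) * fact n"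
    by simp
  ultimately show ?thesis
    unfolding power_Suc by (simp only:) (rule cancel, auto)
qed

text \<open>
  This is the factorisation \<open>sin\<^sup>2 x = (1 - cos x) (2 - (1 - cos x))\<close> under the integral: raising the
  order \<open>n\<close> is the same as inserting these two factors.
\<close>

lemma poisson_moment_Suc_eq:
  "poisson_moment z (Suc n) i =
    z / (2 * real n + 1) * (2 * poisson_moment z n (Suc i) - poisson_moment z n (Suc (Suc i)))"
proof -
  let ?w = "\<lambda>k x. exp (z * cos x) * (1 - cos x) ^ k * sin x ^ (2 * n)"
  have int: "?w k integrable_on {0..pi}" for k
    by (intro integrable_continuous_real continuous_intros)
  have "exp (z * cos x) * (1 - cos x) ^ i * sin x ^ (2 * Suc n) =
      2 * ?w (Suc i) x - ?w (Suc (Suc i)) x" for x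
  proof -
    have "(sin x)\<^sup>2 = (1 - cos x) * (2 - (1 - cos x))"
      by (simp add: sin_squared_eq power2_eq_square algebra_simps)
    then have s: "sin x ^ (2 * Suc n) = sin x ^ (2 * n) * ((1 - cos x) * (2 - (1 - cos x)))"
      by (simp add: power_add power2_eq_square)
    show ?thesis
      unfolding s by (simp add: algebra_simps)
  qed
  then have J: "integral {0..pi} (\<lambda>x. exp (z * cos x) * (1 - cos x) ^ i * sin x ^ (2 * Suc n)) =
      2 * integral {0..pi} (?w (Suc i)) - integral {0..pi} (?w (Suc (Suc i)))"
    using int[of "Suc i"] int[of "Suc (Suc i)"]
    by (simp add: integral_diff integrable_on_cmult_left)
  have "a * b * (2 * v - w) = a * (2 * (b * v) - b * w)" for a b v w :: real
    by (simp add: algebra_simps)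
  then show ?thesis
    unfolding poisson_moment_def poisson_constant_Suc J by blast
qed

text \<open>
  The function \<open>exp (z cos x) (1 - cos x)^i sin x^(2n+1)\<close> vanishes at \<open>0\<close> and \<open>\<pi>\<close>, so its derivative
  has integral zero. Differentiating the exponential produces the moment of order \<open>n+1\<close>,
  differentiating the power of \<open>1 - cos x\<close> the factor \<open>1 + cos x = 2 - (1 - cos x)\<close>, and
  differentiating the power of the sine the factor \<open>cos x = 1 - (1 - cos x)\<close>.
\<close>

lemma poisson_moment_by_parts:
  "(2 * real n + 1) * poisson_moment z (Suc n) i =
    real i * (2 * poisson_moment z n i - poisson_moment z n (Suc i)) +
    (2 * real n + 1) * (poisson_moment z n i - poisson_moment z n (Suc i))"
proof -
  let ?w = "\<lambda>m k x. exp (z * cos x) * (1 - cos x) ^ k * sin x ^ (2 * m)"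
  let ?J = "\<lambda>m k. integral {0..pi} (?w m k)"
  define F where "F x = exp (z * cos x) * (1 - cos x) ^ i * sin x ^ (2 * n + 1)" for x :: real
  define f where "f x = - z * ?w (Suc n) i x + real i * (2 * ?w n i x - ?w n (Suc i) x)
      + (2 * real n + 1) * (?w n i x - ?w n (Suc i) x)" for x :: real
  have "(F has_real_derivative f x) (at x)" for x
  proof -
    have s: "sin x * sin x = (1 - cos x) * (2 - (1 - cos x))"
      using sin_squared_eq[of x] by (simp add: power2_eq_square algebra_simps)
    \<comment> \<open>For \<open>i = 0\<close> the exponent \<open>i - 1\<close> is truncated, and the factor \<open>real i\<close> annihilates the term.\<close>
    have i: "real i * (1 - cos x) ^ (i - Suc 0) * (1 - cos x) = real i * (1 - cos x) ^ i"
      by (cases i) auto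
    have "(F has_real_derivative
        - z * exp (z * cos x) * (1 - cos x) ^ i * sin x ^ (2 * n) * (sin x * sin x)
        + exp (z * cos x) * (real i * (1 - cos x) ^ (i - Suc 0)) * sin x ^ (2 * n) * (sin x * sin x)
        + (2 * real n + 1) * exp (z * cos x) * (1 - cos x) ^ i * sin x ^ (2 * n) * cos x) (at x)"
      unfolding F_def by (rule derivative_eq_intros refl | simp add: algebra_simps)+
    moreover have "exp (z * cos x) * (real i * (1 - cos x) ^ (i - Suc 0)) * sin x ^ (2 * n) * (sin x * sin x)
        = real i * (2 * ?w n i x - ?w n (Suc i) x)"
    proof -
      have "exp (z * cos x) * (real i * (1 - cos x) ^ (i - Suc 0)) * sin x ^ (2 * n) * (sin x * sin x)
        = exp (z * cos x) * sin x ^ (2 * n) * (2 - (1 - cos x)) *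
          (real i * (1 - cos x) ^ (i - Suc 0) * (1 - cos x))"
        unfolding s by (simp only: ac_simps)
      also have "\<dots> = real i * (2 * ?w n i x - ?w n (Suc i) x)"
        unfolding i by (simp add: algebra_simps)
      finally show ?thesis .
    qed
    moreover have "- z * exp (z * cos x) * (1 - cos x) ^ i * sin x ^ (2 * n) * (sin x * sin x) =
        - z * ?w (Suc n) i x"
      by simp
    moreover have "(2 * real n + 1) * exp (z * cos x) * (1 - cos x) ^ i * sin x ^ (2 * n) * cos x =
        (2 * real n + 1) * (?w n i x - ?w n (Suc i) x)"
      by (simp add: algebra_simps)
    ultimately show ?thesis
      unfolding f_def by (simp only:)
  qed
  then have "(f has_integral (F pi - F 0)) {0..pi}"
    by (intro fundamental_theorem_of_calculus)
       (auto simp: has_real_derivative_iff_has_vector_derivative[symmetric]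
             intro: has_field_derivative_at_within)
  then have "integral {0..pi} f = 0"
    by (simp add: F_def integral_unique)
  moreover have "(f has_integral (- z * ?J (Suc n) i + real i * (2 * ?J n i - ?J n (Suc i))
      + (2 * real n + 1) * (?J n i - ?J n (Suc i)))) {0..pi}"
    unfolding f_def
    by (intro has_integral_add has_integral_diff has_integral_mult_right integrable_integral
        integrable_continuous_real continuous_intros)
  ultimately have E: "z * ?J (Suc n) i = real i * (2 * ?J n i - ?J n (Suc i))
      + (2 * real n + 1) * (?J n i - ?J n (Suc i))"
    by (simp add: integral_unique)
  define K where "K = (2 * z) ^ n * fact n / (pi * fact (2 * n))"
  have "(2 * real n + 1) * poisson_moment z (Suc n) i = K * (z * ?J (Suc n) i)"
    unfolding poisson_moment_def poisson_constant_Suc K_def[symmetric] by simp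
  then show ?thesis
    unfolding E unfolding poisson_moment_def K_def[symmetric] by (simp add: algebra_simps)
qed

text \<open>
  Integration by parts alone leaves the coefficient \<open>i / (2n+1)\<close>; absorbing the factors
  \<open>(1 - cos x) (2 - (1 - cos x))\<close> into a sine of higher power turns it into \<open>i / z\<close>, which is
  independent of \<open>n\<close>. This is what makes the identity fit for iteration. For \<open>i = 0\<close> the truncated
  index \<open>i - 1\<close> is harmless, since its coefficient vanishes.
\<close>

lemma poisson_moment_diff:
  assumes "z > 0"
  shows "poisson_moment z n i - poisson_moment z (Suc n) i =
    poisson_moment z n (Suc i) - real i / z * poisson_moment z (Suc n) (i - 1)"
proof (cases i)
  case 0
  then show ?thesis
    using poisson_moment_by_parts[of n z 0] by (simp flip: right_diff_distrib)
next
  case (Suc k)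
  have "real i / z * poisson_moment z (Suc n) (i - 1) =
      real i * (2 * poisson_moment z n i - poisson_moment z n (Suc i)) / (2 * real n + 1)"
    using assms by (simp add: Suc poisson_moment_Suc_eq[of z n k])
  moreover have "poisson_moment z (Suc n) i =
      real i * (2 * poisson_moment z n i - poisson_moment z n (Suc i)) / (2 * real n + 1)
      + (poisson_moment z n i - poisson_moment z n (Suc i))"
    using poisson_moment_by_parts[of n z i]
    by (simp add: field_simps add_divide_distrib)
  ultimately show ?thesis
    by simp
qed

text \<open>
  Removes the shift \<open>n+1\<close> that the second term of the difference identity introduces.
\<close>

lemma poisson_moment_Suc_le:
  assumes "z > 0"
  shows "poisson_moment z (Suc n) i \<le> (1 + 2 * real i) * poisson_moment z n i"
proof -
  have "(2 * real n + 1 + real i) * poisson_moment z n (Suc i) \<ge> 0"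
    by (intro mult_nonneg_nonneg poisson_moment_nonneg assms) auto
  then have "(2 * real n + 1) * poisson_moment z (Suc n) i \<le>
      (2 * real n + 1 + 2 * real i) * poisson_moment z n i"
    using poisson_moment_by_parts[of n z i] by (simp add: algebra_simps)
  also have "\<dots> \<le> (2 * real n + 1) * ((1 + 2 * real i) * poisson_moment z n i)"
    using poisson_moment_nonneg[OF assms, of n i] by (simp add: algebra_simps)
  finally show ?thesis
    by (rule mult_left_le_imp_le) simp
qed

text \<open>
  By \<open>poisson_moment_Suc_eq\<close>, \<open>M(n+1,i)\<close> differs from \<open>M(n,i+1)\<close> essentially by a factor
  \<open>1 + cos x\<close> in the integrand, so the point is that this factor cannot make the integral small.
  Integration by parts at exponent \<open>i+1\<close> and the nonnegativity of \<open>M(n+1,i+1)\<close> bound the mean of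
  \<open>1 + cos x\<close> under the integrand of \<open>M(n,i+1)\<close> from below by \<open>(2n+1) / (2n+i+2)\<close>, which is at least \<open>1 / (i+2)\<close> for all \<open>n\<close>.
\<close>

lemma poisson_moment_trade:
  assumes "z > 0"
  shows "poisson_moment z n (Suc i) \<le>
    (real i + 2) * (2 * real n + 1) / z * poisson_moment z (Suc n) i"
proof -
  let ?A = "poisson_moment z n (Suc i)" and ?B = "poisson_moment z n (Suc (Suc i))"
  define b where "b = 2 * real n + 1"
  have b: "b \<ge> 1" by (simp add: b_def)
  have "0 \<le> b * poisson_moment z (Suc n) (Suc i)"
    using b by (intro mult_nonneg_nonneg poisson_moment_nonneg assms) auto
  also have "\<dots> = (real i + 1) * (2 * ?A - ?B) + b * (?A - ?B)"
    using poisson_moment_by_parts[of n z "Suc i"] by (simp add: b_def)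
  finally have "0 \<le> (real i + 1) * (2 * ?A - ?B) + b * (?A - ?B)" .
  then have *: "b * ?A \<le> (b + real i + 1) * (2 * ?A - ?B)"
    by (simp add: algebra_simps)
  then have "0 \<le> (b + real i + 1) * (2 * ?A - ?B)"
    using b poisson_moment_nonneg[OF assms, of n "Suc i"]
    by (meson mult_nonneg_nonneg order_trans zero_le_one)
  then have nn: "0 \<le> 2 * ?A - ?B"
    using b by (simp add: zero_le_mult_iff)
  have "b + real i + 1 \<le> b * (real i + 2)"
    using b mult_right_mono[of 1 b "real i + 1"] by (simp add: algebra_simps)
  then have "b * ?A \<le> b * (real i + 2) * (2 * ?A - ?B)"
    using * nn by (meson mult_right_mono order_trans)
  then have "b * ?A \<le> b * ((real i + 2) * (2 * ?A - ?B))"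
    by (simp only: mult.assoc)
  then have "?A \<le> (real i + 2) * (2 * ?A - ?B)"
    using b by (simp add: mult_le_cancel_left_pos)
  also have "\<dots> = (real i + 2) * (2 * real n + 1) / z * poisson_moment z (Suc n) i"
    using assms b by (simp add: poisson_moment_Suc_eq[of z n i] flip: b_def)
  finally show ?thesis .
qed

lemma poisson_moment_le_power:
  "\<exists>C>0. \<forall>n z. z > 0 \<longrightarrow>
    poisson_moment z n i \<le> C * ((2 * real n + 1) / z) ^ i * poisson_moment z (n + i) 0"
proof (induction i)
  case 0
  show ?case by (intro exI[of _ 1]) auto
next
  case (Suc i)
  then obtain C where C: "C > 0" and le: "\<And>n z. z > 0 \<Longrightarrow>
      poisson_moment z n i \<le> C * ((2 * real n + 1) / z) ^ i * poisson_moment z (n + i) 0"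
    by blast
  \<comment> \<open>The hypothesis is used at order \<open>n+1\<close>, and \<open>2(n+1)+1 \<le> 3(2n+1)\<close> accounts for the power of \<open>3\<close>.\<close>
  show ?case
  proof (intro exI[of _ "(real i + 2) * (C * 3 ^ i)"] conjI allI impI)
    show "(real i + 2) * (C * 3 ^ i) > 0"
      using C by simp
    fix n and z :: real
    assume z: "z > 0"
    define y where "y = (2 * real n + 1) / z"
    have y: "y \<ge> 0" using z by (simp add: y_def)
    have "(2 * real (Suc n) + 1) / z \<le> 3 * y"
      using z by (simp add: y_def divide_simps)
    then have "((2 * real (Suc n) + 1) / z) ^ i \<le> (3 * y) ^ i"
      using z by (intro power_mono) auto
    then have "C * ((2 * real (Suc n) + 1) / z) ^ i * poisson_moment z (Suc n + i) 0 \<le>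
        C * (3 * y) ^ i * poisson_moment z (Suc n + i) 0"
      using C poisson_moment_nonneg[OF z] by (intro mult_right_mono mult_left_mono) auto
    with le[OF z, of "Suc n"]
    have "poisson_moment z (Suc n) i \<le> C * (3 * y) ^ i * poisson_moment z (Suc n + i) 0"
      by linarith
    then have "(real i + 2) * y * poisson_moment z (Suc n) i \<le>
        (real i + 2) * y * (C * (3 * y) ^ i * poisson_moment z (Suc n + i) 0)"
      using y by (intro mult_left_mono) auto
    moreover have "poisson_moment z n (Suc i) \<le> (real i + 2) * y * poisson_moment z (Suc n) i"
      using poisson_moment_trade[OF z, of n i] by (simp add: y_def)
    ultimately show "poisson_moment z n (Suc i) \<le> (real i + 2) * (C * 3 ^ i) *
        ((2 * real n + 1) / z) ^ Suc i * poisson_moment z (n + Suc i) 0"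
      unfolding y_def[symmetric] by (simp add: power_mult_distrib ac_simps)
  qed
qed

section \<open>Iterated differences of Poisson moments\<close>

text \<open>
  Moments are indexed by natural numbers. The differences look only to the right, so on
  nonnegative indices they agree with those of \<^const>\<open>delta_right\<close>.
\<close>

definition ndelta :: "(nat \<Rightarrow> real) \<Rightarrow> nat \<Rightarrow> real" where
  "ndelta f n = f n - f (Suc n)"

lemma delta_right_funpow_int:
  "(delta_right ^^ l) f (int n) = (ndelta ^^ l) (\<lambda>m. f (int m)) n"
proof (induction l arbitrary: n)
  case (Suc l)
  show ?case
    using Suc[of n] Suc[of "Suc n"] by (simp add: delta_right_def ndelta_def add.commute)
qed simp

lemma ndelta_funpow_diff_shift:
  "(ndelta ^^ l) (\<lambda>m. f m - c * g (Suc m)) n = (ndelta ^^ l) f n - c * (ndelta ^^ l) g (Suc n)"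
  by (induction l arbitrary: n) (simp_all add: ndelta_def algebra_simps)

lemma ndelta_funpow_cmult:
  "(ndelta ^^ l) (\<lambda>m. c * f m) n = c * (ndelta ^^ l) f n"
  by (induction l arbitrary: n) (simp_all add: ndelta_def algebra_simps)

text \<open>
  Induction on \<open>l\<close> for all \<open>i\<close> at once, peeling off the innermost difference: by
  \<open>poisson_moment_diff\<close> it replaces the exponent \<open>i\<close> by \<open>i+1\<close>, or by \<open>i-1\<close> together with a
  factor \<open>1/z\<close>. Both have weight \<open>i+1\<close>, so the terms \<open>M(n,k) / z^j\<close> that occur all satisfy
  \<open>k + 2j = l + i\<close>.
\<close>

lemma ndelta_funpow_moment_le:
  "\<exists>C\<ge>0. \<forall>n z. z > 0 \<longrightarrow> \<bar>(ndelta ^^ l) (\<lambda>m. poisson_moment z m i) n\<bar> \<le>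
    C * (\<Sum>j\<le>(l + i) div 2. poisson_moment z n (l + i - 2 * j) / z ^ j)"
proof (induction l arbitrary: i)
  case 0
  have "poisson_moment z n i \<le> (\<Sum>j\<le>i div 2. poisson_moment z n (i - 2 * j) / z ^ j)"
    if "z > 0" for n z
    using member_le_sum[of 0 "{..i div 2}" "\<lambda>j. poisson_moment z n (i - 2 * j) / z ^ j"]
      poisson_moment_nonneg[OF that] that by simp
  then show ?case
    using poisson_moment_nonneg by (intro exI[of _ 1]) auto
next
  case (Suc l)
  obtain C where C: "C \<ge> 0" and C_le: "\<And>n z. z > 0 \<Longrightarrow>
      \<bar>(ndelta ^^ l) (\<lambda>m. poisson_moment z m (Suc i)) n\<bar> \<le>
        C * (\<Sum>j\<le>(l + Suc i) div 2. poisson_moment z n (l + Suc i - 2 * j) / z ^ j)"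
    using Suc[of "Suc i"] by blast
  obtain D where D: "D \<ge> 0" and D_le: "\<And>n z. z > 0 \<Longrightarrow>
      \<bar>(ndelta ^^ l) (\<lambda>m. poisson_moment z m (i - 1)) n\<bar> \<le>
        D * (\<Sum>j\<le>(l + (i - 1)) div 2. poisson_moment z n (l + (i - 1) - 2 * j) / z ^ j)"
    using Suc[of "i - 1"] by blast
  \<comment> \<open>\<open>E\<close> bounds the cost of shifting \<open>n+1\<close> back to \<open>n\<close> in every moment of exponent at most \<open>l + i\<close>.\<close>
  define E where "E = 1 + 2 * real (l + i)"
  show ?case
  proof (intro exI[of _ "C + real i * D * E"] conjI allI impI)
    show "0 \<le> C + real i * D * E"
      using C D by (simp add: E_def)
    fix n and z :: real
    assume z: "z > 0"
    let ?S = "\<Sum>j\<le>(Suc l + i) div 2. poisson_moment z n (Suc l + i - 2 * j) / z ^ j"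
    have "(ndelta ^^ Suc l) (\<lambda>m. poisson_moment z m i) n =
        (ndelta ^^ l) (\<lambda>m. poisson_moment z m (Suc i)
          - real i / z * poisson_moment z (Suc m) (i - 1)) n"
      unfolding funpow_Suc_right o_def by (simp only: ndelta_def[abs_def] poisson_moment_diff[OF z])
    also have "\<dots> = (ndelta ^^ l) (\<lambda>m. poisson_moment z m (Suc i)) n
        - real i / z * (ndelta ^^ l) (\<lambda>m. poisson_moment z m (i - 1)) (Suc n)"
      by (rule ndelta_funpow_diff_shift)
    finally have "\<bar>(ndelta ^^ Suc l) (\<lambda>m. poisson_moment z m i) n\<bar> \<le>
        \<bar>(ndelta ^^ l) (\<lambda>m. poisson_moment z m (Suc i)) n\<bar>
        + real i / z * \<bar>(ndelta ^^ l) (\<lambda>m. poisson_moment z m (i - 1)) (Suc n)\<bar>"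
      using z abs_triangle_ineq4[of "(ndelta ^^ l) (\<lambda>m. poisson_moment z m (Suc i)) n"
        "real i / z * (ndelta ^^ l) (\<lambda>m. poisson_moment z m (i - 1)) (Suc n)"]
      by (simp add: abs_mult)
    moreover have "\<bar>(ndelta ^^ l) (\<lambda>m. poisson_moment z m (Suc i)) n\<bar> \<le> C * ?S"
      using C_le[OF z, of n] by simp
    moreover have "real i / z * \<bar>(ndelta ^^ l) (\<lambda>m. poisson_moment z m (i - 1)) (Suc n)\<bar>
        \<le> real i * D * E * ?S"
    proof (cases i)
      case (Suc k)
      have "poisson_moment z (Suc n) (l + k - 2 * j) / z ^ j
          \<le> E * (poisson_moment z n (l + k - 2 * j) / z ^ j)" for j
      proof -
        have "(1 + 2 * real (l + k - 2 * j)) * poisson_moment z n (l + k - 2 * j)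
            \<le> E * poisson_moment z n (l + k - 2 * j)"
          by (intro mult_right_mono poisson_moment_nonneg z) (simp add: E_def Suc)
        with poisson_moment_Suc_le[OF z, of n "l + k - 2 * j"]
        have "poisson_moment z (Suc n) (l + k - 2 * j) \<le> E * poisson_moment z n (l + k - 2 * j)"
          by linarith
        then show ?thesis
          using z by (simp add: divide_right_mono)
      qed
      then have "(\<Sum>j\<le>(l + k) div 2. poisson_moment z (Suc n) (l + k - 2 * j) / z ^ j)
          \<le> E * (\<Sum>j\<le>(l + k) div 2. poisson_moment z n (l + k - 2 * j) / z ^ j)"
        unfolding sum_distrib_left by (intro sum_mono)
      \<comment> \<open>The factor \<open>1/z\<close> is moved into the sum, so that index \<open>j\<close> becomes \<open>j+1\<close>.\<close>
      also have "\<dots> = E * (z * (\<Sum>j\<le>(l + k) div 2.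
          poisson_moment z n (Suc l + i - 2 * Suc j) / z ^ Suc j))"
        using z by (simp add: sum_distrib_left Suc)
      also have "\<dots> \<le> E * (z * ?S)"
      proof -
        have "(Suc l + i) div 2 = Suc ((l + k) div 2)"
          by (simp add: Suc)
        then have "(\<Sum>j\<le>(l + k) div 2. poisson_moment z n (Suc l + i - 2 * Suc j) / z ^ Suc j) \<le> ?S"
          using poisson_moment_nonneg[OF z] by (simp only: sum.atMost_Suc_shift) simp
        then show ?thesis
          using z by (intro mult_left_mono) (auto simp: E_def)
      qed
      finally have "D * (\<Sum>j\<le>(l + k) div 2. poisson_moment z (Suc n) (l + k - 2 * j) / z ^ j)
          \<le> D * (E * (z * ?S))"
        using D by (rule mult_left_mono)
      with D_le[OF z, of "Suc n"]
      have "\<bar>(ndelta ^^ l) (\<lambda>m. poisson_moment z m (i - 1)) (Suc n)\<bar> \<le> D * (E * (z * ?S))"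
        by (simp add: Suc)
      then have "real i / z * \<bar>(ndelta ^^ l) (\<lambda>m. poisson_moment z m (i - 1)) (Suc n)\<bar>
          \<le> real i / z * (D * (E * (z * ?S)))"
        using z by (intro mult_left_mono) auto
      also have "\<dots> = real i * D * E * ?S"
        using z by simp
      finally show ?thesis .
    qed simp
    ultimately show "\<bar>(ndelta ^^ Suc l) (\<lambda>m. poisson_moment z m i) n\<bar> \<le> (C + real i * D * E) * ?S"
      unfolding distrib_right by linarith
  qed
qed

section \<open>The Poisson integral for the Bessel function\<close>

definition wallis :: "nat \<Rightarrow> nat \<Rightarrow> real" where
  "wallis k n = integral {0..pi} (\<lambda>x. cos x ^ k * sin x ^ (2 * n))"

lemma has_integral_wallis:
  "((\<lambda>x. cos x ^ k * sin x ^ (2 * n)) has_integral wallis k n) {0..pi}"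
  unfolding wallis_def by (intro integrable_integral integrable_continuous_real continuous_intros)

lemma wallis_split: "wallis k n = wallis (k + 2) n + wallis k (Suc n)"
proof -
  have "cos x ^ k * sin x ^ (2 * n) = cos x ^ (k + 2) * sin x ^ (2 * n) + cos x ^ k * sin x ^ (2 * Suc n)"
    for x :: real
  proof -
    have "cos x ^ (k + 2) * sin x ^ (2 * n) + cos x ^ k * sin x ^ (2 * Suc n) =
        cos x ^ k * sin x ^ (2 * n) * ((cos x)\<^sup>2 + (sin x)\<^sup>2)"
      by (simp only: mult_Suc_right power_add power2_eq_square distrib_left) (simp only: ac_simps)
    then show ?thesis by simp
  qed
  then show ?thesis
    using has_integral_add[OF has_integral_wallis[of "k + 2" n] has_integral_wallis[of k "Suc n"]]
      has_integral_wallis[of k n] by (auto intro: has_integral_unique)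
qed

text \<open>
  The integrand is the derivative of \<open>cos x^k sin x^(2n+1)\<close>, which vanishes at both endpoints.
\<close>

lemma has_integral_wallis_derivative:
  "((\<lambda>x. (2 * real n + 1) * (cos x ^ Suc k * sin x ^ (2 * n))
      - real k * (cos x ^ (k - 1) * sin x ^ (2 * Suc n))) has_integral 0) {0..pi}"
proof -
  define F where "F x = cos x ^ k * sin x ^ (2 * n + 1)" for x :: real
  have "(F has_real_derivative (2 * real n + 1) * (cos x ^ Suc k * sin x ^ (2 * n))
      - real k * (cos x ^ (k - 1) * sin x ^ (2 * Suc n))) (at x)" for x
    unfolding F_def by (rule derivative_eq_intros refl | simp add: algebra_simps)+
  then have "((\<lambda>x. (2 * real n + 1) * (cos x ^ Suc k * sin x ^ (2 * n))
      - real k * (cos x ^ (k - 1) * sin x ^ (2 * Suc n))) has_integral (F pi - F 0)) {0..pi}"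
    by (intro fundamental_theorem_of_calculus)
       (auto simp: has_real_derivative_iff_has_vector_derivative[symmetric]
             intro: has_field_derivative_at_within)
  then show ?thesis
    by (simp add: F_def)
qed

lemma wallis_by_parts:
  "(2 * real n + 1) * wallis (Suc k) n = real k * wallis (k - 1) (Suc n)"
proof -
  have "((\<lambda>x. (2 * real n + 1) * (cos x ^ Suc k * sin x ^ (2 * n))
      - real k * (cos x ^ (k - 1) * sin x ^ (2 * Suc n))) has_integral
      (2 * real n + 1) * wallis (Suc k) n - real k * wallis (k - 1) (Suc n)) {0..pi}"
    by (intro has_integral_diff has_integral_mult_right has_integral_wallis)
  then show ?thesis
    using has_integral_unique[OF _ has_integral_wallis_derivative] by fastforce
qed

lemma wallis_odd: "odd k \<Longrightarrow> wallis k n = 0"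
proof (induction k arbitrary: n rule: less_induct)
  case (less k)
  then obtain m where m: "k = Suc m" by (cases k) auto
  have "real m * wallis (m - 1) (Suc n) = 0"
  proof (cases "m = 0")
    case False
    with less.prems m show ?thesis
      by (subst less.IH) auto
  qed simp
  then have "(2 * real n + 1) * wallis k n = 0"
    unfolding m by (simp only: wallis_by_parts)
  then show ?case
    by (simp add: add_nonneg_eq_0_iff)
qed

text \<open>
  Splitting by \<open>sin\<^sup>2 + cos\<^sup>2 = 1\<close> and integration by parts together give a first-order recursion in
  either index. The first column \<open>wallis 0 n\<close> is computed from \<open>wallis 0 0 = \<pi>\<close>, and the recursion in
  \<open>m\<close> does the rest.
\<close>

lemma wallis_even:
  "wallis (2 * m) n = pi * fact (2 * m) * fact (2 * n) / (4 ^ (m + n) * fact m * fact n * fact (m + n))"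
proof -
  have up: "wallis (2 * Suc m) n = (2 * real m + 1) / (2 * (real m + real n + 1)) * wallis (2 * m) n" for m n
  proof -
    have "(2 * real n + 1) * wallis (2 * Suc m) n = (2 * real m + 1) * wallis (2 * m) (Suc n)"
      using wallis_by_parts[of n "2 * m + 1"] by simp
    also have "wallis (2 * m) (Suc n) = wallis (2 * m) n - wallis (2 * Suc m) n"
      using wallis_split[of "2 * m" n] by simp
    finally have "(2 * (real m + real n + 1)) * wallis (2 * Suc m) n = (2 * real m + 1) * wallis (2 * m) n"
      by (simp add: algebra_simps)
    then show ?thesis
      by (simp add: field_simps)
  qed
  have zero: "wallis 0 n = pi * fact (2 * n) / (4 ^ n * fact n * fact n)" for n
  proof (induction n)
    case 0
    show ?case by (simp add: wallis_def)
  next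
    case (Suc n)
    have "wallis 0 (Suc n) = wallis 0 n - wallis 2 n"
      using wallis_split[of 0 n] by (simp add: numeral_2_eq_2)
    also have "\<dots> = (2 * real n + 1) / (2 * (real n + 1)) * wallis 0 n"
      using up[of 0 n] by (simp add: field_simps numeral_2_eq_2)
    also have "\<dots> = pi * ((2 * real n + 2) * (2 * real n + 1) * fact (2 * n)) /
        (4 ^ Suc n * ((real n + 1) * fact n) * ((real n + 1) * fact n))"
      unfolding Suc
    proof -
      have "real n + 1 \<noteq> 0" "2 * real n + 2 = 2 * (real n + 1)" by auto
      then show "(2 * real n + 1) / (2 * (real n + 1)) * (pi * fact (2 * n) / (4 ^ n * fact n * fact n)) =
          pi * ((2 * real n + 2) * (2 * real n + 1) * fact (2 * n)) /
          (4 ^ Suc n * ((real n + 1) * fact n) * ((real n + 1) * fact n))"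
        by (simp only:) (simp add: divide_simps, simp add: algebra_simps)
    qed
    also have "\<dots> = pi * fact (2 * Suc n) / (4 ^ Suc n * fact (Suc n) * fact (Suc n))"
      by (simp add: algebra_simps)
    finally show ?case .
  qed
  show ?thesis
  proof (induction m)
    case 0
    show ?case by (simp add: zero)
  next
    case (Suc m)
    have "wallis (2 * Suc m) n = pi * ((2 * real m + 2) * (2 * real m + 1) * fact (2 * m)) * fact (2 * n) /
        (4 ^ Suc (m + n) * ((real m + 1) * fact m) * fact n * ((real m + real n + 1) * fact (m + n)))"
    proof -
      have "real m + 1 \<noteq> 0" "real m + real n + 1 \<noteq> 0" "2 * real m + 2 = 2 * (real m + 1)" by auto
      then show ?thesis
        unfolding up Suc by (simp only:) (simp add: divide_simps, simp add: algebra_simps)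
    qed
    then show ?case
      by (simp add: algebra_simps)
  qed
qed

text \<open>
  The exponential series may be integrated term by term, because it converges uniformly by the
  Weierstrass criterion with majorant \<open>\<bar>z\<bar>^k / k!\<close>.
\<close>

lemma exp_cos_integral_sums:
  "(\<lambda>k. z ^ k / fact k * wallis k n) sums
    integral {0..pi} (\<lambda>x. exp (z * cos x) * sin x ^ (2 * n))"
proof -
  let ?f = "\<lambda>k x. z ^ k / fact k * (cos x ^ k * sin x ^ (2 * n))"
  let ?g = "\<lambda>x. exp (z * cos x) * sin x ^ (2 * n)"
  have "uniform_limit {0..pi} (\<lambda>N x. \<Sum>k<N. ?f k x) (\<lambda>x. \<Sum>k. ?f k x) sequentially"
  proof (rule Weierstrass_m_test)
    fix k and x :: real
    have "\<bar>cos x\<bar> ^ k * \<bar>sin x\<bar> ^ (2 * n) \<le> 1 * 1"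
      by (intro mult_mono power_le_one) auto
    then have "\<bar>z\<bar> ^ k / fact k * (\<bar>cos x\<bar> ^ k * \<bar>sin x\<bar> ^ (2 * n)) \<le> \<bar>z\<bar> ^ k / fact k * 1"
      by (intro mult_left_mono) auto
    then show "norm (?f k x) \<le> \<bar>z\<bar> ^ k / fact k"
      by (simp add: abs_mult power_abs)
    show "summable (\<lambda>k. \<bar>z\<bar> ^ k / fact k)"
      using summable_exp[of "\<bar>z\<bar>"] by (simp add: field_simps)
  qed
  moreover have "(\<Sum>k. ?f k x) = ?g x" for x
  proof -
    have "(\<lambda>k. (z * cos x) ^ k /\<^sub>R fact k * sin x ^ (2 * n)) sums ?g x"
      by (intro sums_mult2 exp_converges)
    then show ?thesis
      by (intro sums_unique[symmetric]) (simp add: power_mult_distrib field_simps)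
  qed
  ultimately have "uniform_limit {0..pi} (\<lambda>N x. \<Sum>k<N. ?f k x) ?g sequentially"
    by simp
  then obtain I J where I: "\<And>N. ((\<lambda>x. \<Sum>k<N. ?f k x) has_integral I N) {0..pi}"
    and J: "(?g has_integral J) {0..pi}" and lim: "I \<longlonglongrightarrow> J"
    by (rule uniform_limit_integral) (auto intro!: continuous_intros)
  have "((\<lambda>x. \<Sum>k<N. ?f k x) has_integral (\<Sum>k<N. z ^ k / fact k * wallis k n)) {0..pi}" for N
    by (intro has_integral_sum has_integral_mult_right has_integral_wallis) auto
  with I have "I = (\<lambda>N. \<Sum>k<N. z ^ k / fact k * wallis k n)"
    by (blast intro: has_integral_unique)
  with lim J show ?thesis
    by (simp add: sums_def integral_unique)
qed

text \<open>
  In the integrated exponential series the odd terms vanish, and the even ones reproduce the power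
  series of the Bessel function by the evaluation of the Wallis integrals.
\<close>

lemma bessel_I_nat_eq_poisson_moment: "bessel_I_nat n z = poisson_moment z n 0"
proof -
  let ?a = "\<lambda>k. z ^ k / fact k * wallis k n"
  let ?J = "integral {0..pi} (\<lambda>x. exp (z * cos x) * sin x ^ (2 * n))"
  have "(\<lambda>m. ?a (2 * m)) sums ?J"
  proof (subst sums_mono_reindex)
    show "strict_mono (\<lambda>m::nat. 2 * m)"
      by (simp add: strict_mono_def)
    show "?a k = 0" if "k \<notin> range (\<lambda>m. 2 * m)" for k
    proof -
      have "odd k"
        using that by (auto elim!: evenE)
      then show ?thesis
        by (simp add: wallis_odd)
    qed
    show "?a sums ?J" by (rule exp_cos_integral_sums)
  qed
  then have "(\<lambda>m. (2 * z) ^ n * fact n / (pi * fact (2 * n)) * ?a (2 * m)) sums poisson_moment z n 0"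
    unfolding poisson_moment_def power_0 mult_1_right by (rule sums_mult)
  moreover have "(2 * z) ^ n * fact n / (pi * fact (2 * n)) * ?a (2 * m) =
      1 / (fact m * Gamma (real m + real n + 1)) * (z / 2) ^ (2 * m + n)" for m
  proof -
    have "Gamma (real m + real n + 1) = fact (m + n)"
      using Gamma_fact[of "m + n", where 'a = real] by (simp add: add_ac)
    moreover have "(4::real) ^ (m + n) = 2 ^ (2 * m + n) * 2 ^ n"
      by (simp add: power_add power_mult power_mult_distrib[symmetric])
    ultimately show ?thesis
      by (simp add: wallis_even power_divide power_add power_mult_distrib) (simp only: ac_simps)
  qed
  ultimately show ?thesis
    unfolding bessel_I_nat_def by (simp add: sums_iff)
qed

section \<open>The estimate for the heat kernel\<close>

lemma heat_G_eq_poisson_moment: "heat_G t (int n) = exp (- 2 * t) * poisson_moment (2 * t) n 0"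
  by (simp add: heat_G_def bessel_I_def bessel_I_nat_eq_poisson_moment)

text \<open>
  The real powers in the estimate combine to the integer powers delivered by the moment bounds.
\<close>

lemma powr_term_eq:
  assumes "t > 0" "a > 0" "2 * u \<le> l"
  shows "1 / t powr (real l / 2) * (a\<^sup>2 / t) powr (real l / 2 - real u) = (a / t) ^ (l - 2 * u) / t ^ u"
proof -
  let ?p = "real l / 2 - real u"
  have "(a\<^sup>2) powr ?p = a powr (2 * ?p)"
    using assms by (simp add: powr_powr flip: powr_numeral)
  also have "2 * ?p = real (l - 2 * u)"
    using assms by (simp add: of_nat_diff)
  finally have a: "(a\<^sup>2) powr ?p = a ^ (l - 2 * u)"
    using assms by (simp only: powr_realpow)
  have "t powr (real l / 2) * t powr ?p = t powr (real (l - 2 * u) + real u)"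
    using assms by (simp add: of_nat_diff flip: powr_add)
  also have "\<dots> = t ^ (l - 2 * u) * t ^ u"
    unfolding powr_add using assms by (simp only: powr_realpow)
  finally have t: "t powr (real l / 2) * t powr ?p = t ^ (l - 2 * u) * t ^ u" .
  have "1 / t powr (real l / 2) * (a\<^sup>2 / t) powr ?p = (a\<^sup>2) powr ?p / (t powr (real l / 2) * t powr ?p)"
    using assms by (simp add: powr_divide)
  also have "\<dots> = (a / t) ^ (l - 2 * u) / t ^ u"
    unfolding a t by (simp add: power_divide)
  finally show ?thesis .
qed

theorem lemma4:
  fixes l :: nat
  assumes "l \<ge> 1"
  shows "\<exists>C::real. C > 0 \<and> (\<forall>(n::nat) (t::real). t > 0 \<longrightarrow>
    \<bar>(delta_right ^^ l) (heat_G t) (int n)\<bar> \<le>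
      C / t powr (real l / 2) *
        (\<Sum>u = 0..l div 2. ((real n + 1 / 2)\<^sup>2 / t) powr (real l / 2 - real u)
            * heat_G t (int n + int l - 2 * int u))
      + C * heat_G t (int n) * (\<Sum>u = l div 2 + 1..l - 1. 1 / t ^ u))"
proof -
  obtain C where C: "C \<ge> 0" and C_le: "\<And>n z. z > 0 \<Longrightarrow>
      \<bar>(ndelta ^^ l) (\<lambda>m. poisson_moment z m 0) n\<bar> \<le>
        C * (\<Sum>j\<le>l div 2. poisson_moment z n (l - 2 * j) / z ^ j)"
    using ndelta_funpow_moment_le[of l 0] by auto
  obtain B where B: "\<And>i. B i > 0" and B_le: "\<And>i n z. z > 0 \<Longrightarrow>
      poisson_moment z n i \<le> B i * ((2 * real n + 1) / z) ^ i * poisson_moment z (n + i) 0"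
    using poisson_moment_le_power by metis
  \<comment> \<open>One constant that serves for all exponents \<open>l - 2u\<close> at once.\<close>
  define D where "D = (\<Sum>i\<le>l. B i)"
  have D: "D \<ge> 0" "\<And>i. i \<le> l \<Longrightarrow> B i \<le> D"
    unfolding D_def using B by (auto intro!: sum_nonneg member_le_sum simp: less_imp_le)
  define A where "A = C * D + 1"
  show ?thesis
  proof (intro exI[of _ A] conjI allI impI)
    show "A > 0" using C D by (simp add: A_def add_nonneg_pos)
    fix n and t :: real
    assume t: "t > 0"
    define a where "a = real n + 1 / 2"
    have a: "a > 0" by (simp add: a_def add_nonneg_pos)
    have G_nonneg: "heat_G t (int m) \<ge> 0" for m
      unfolding heat_G_eq_poisson_moment using t by (simp add: poisson_moment_nonneg)
    let ?T = "\<lambda>u. (a / t) ^ (l - 2 * u) / t ^ u * heat_G t (int (n + (l - 2 * u)))"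
    have T_nonneg: "?T u \<ge> 0" for u
      by (intro mult_nonneg_nonneg divide_nonneg_nonneg zero_le_power G_nonneg) (use a t in auto)
    have term_le: "exp (- 2 * t) * (poisson_moment (2 * t) n (l - 2 * u) / (2 * t) ^ u) \<le> D * ?T u" for u
    proof -
      let ?i = "l - 2 * u"
      have "(2 * real n + 1) / (2 * t) = a / t"
        by (simp add: a_def field_simps)
      then have "poisson_moment (2 * t) n ?i \<le> B ?i * (a / t) ^ ?i * poisson_moment (2 * t) (n + ?i) 0"
        using B_le[of "2 * t" n ?i] t by simp
      also have "\<dots> \<le> D * (a / t) ^ ?i * poisson_moment (2 * t) (n + ?i) 0"
        using D(2)[of ?i] a t by (intro mult_right_mono poisson_moment_nonneg) auto
      finally have le: "poisson_moment (2 * t) n ?i \<le> D * (a / t) ^ ?i * poisson_moment (2 * t) (n + ?i) 0" .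
      have "t ^ u \<le> (2 * t) ^ u"
        using t by (intro power_mono) auto
      then have "poisson_moment (2 * t) n ?i / (2 * t) ^ u \<le>
          (D * (a / t) ^ ?i * poisson_moment (2 * t) (n + ?i) 0) / t ^ u"
        using t le D(1) a poisson_moment_nonneg[of "2 * t"] by (intro frac_le) auto
      then have "exp (- 2 * t) * (poisson_moment (2 * t) n ?i / (2 * t) ^ u) \<le>
          exp (- 2 * t) * ((D * (a / t) ^ ?i * poisson_moment (2 * t) (n + ?i) 0) / t ^ u)"
        by (intro mult_left_mono) auto
      then show ?thesis
        unfolding heat_G_eq_poisson_moment by (simp add: ac_simps)
    qed
    have "\<bar>(delta_right ^^ l) (heat_G t) (int n)\<bar> =
        exp (- 2 * t) * \<bar>(ndelta ^^ l) (\<lambda>m. poisson_moment (2 * t) m 0) n\<bar>"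
      by (simp add: delta_right_funpow_int heat_G_eq_poisson_moment ndelta_funpow_cmult abs_mult)
    also have "\<dots> \<le> exp (- 2 * t) *
        (C * (\<Sum>j\<le>l div 2. poisson_moment (2 * t) n (l - 2 * j) / (2 * t) ^ j))"
      using t by (intro mult_left_mono C_le) auto
    also have "\<dots> = C * (\<Sum>j\<le>l div 2. exp (- 2 * t) *
        (poisson_moment (2 * t) n (l - 2 * j) / (2 * t) ^ j))"
      by (simp add: sum_distrib_left ac_simps)
    also have "\<dots> \<le> C * (\<Sum>u\<le>l div 2. D * ?T u)"
      by (rule mult_left_mono[OF sum_mono[OF term_le] C])
    also have "\<dots> = C * D * (\<Sum>u\<le>l div 2. ?T u)"
      by (simp add: sum_distrib_left mult.assoc)
    also have "\<dots> \<le> A * (\<Sum>u\<le>l div 2. ?T u)"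
      by (rule mult_right_mono[OF _ sum_nonneg[OF T_nonneg]]) (simp add: A_def)
    also have "(\<Sum>u\<le>l div 2. ?T u) = (\<Sum>u = 0..l div 2. 1 / t powr (real l / 2) *
        ((a\<^sup>2 / t) powr (real l / 2 - real u) * heat_G t (int n + int l - 2 * int u)))"
    proof (rule sum.cong)
      fix u assume "u \<in> {0..l div 2}"
      then have u: "2 * u \<le> l" by auto
      then have "int (n + (l - 2 * u)) = int n + int l - 2 * int u"
        by simp
      then show "?T u = 1 / t powr (real l / 2) *
          ((a\<^sup>2 / t) powr (real l / 2 - real u) * heat_G t (int n + int l - 2 * int u))"
        using powr_term_eq[OF t a u] by (simp only: mult.assoc[symmetric])
    qed auto
    also have "A * \<dots> = A / t powr (real l / 2) * (\<Sum>u = 0..l div 2.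
        (a\<^sup>2 / t) powr (real l / 2 - real u) * heat_G t (int n + int l - 2 * int u))"
      unfolding sum_distrib_left[symmetric] by simp
    finally have "\<bar>(delta_right ^^ l) (heat_G t) (int n)\<bar> \<le> \<dots>" .
    moreover have "A * heat_G t (int n) * (\<Sum>u = l div 2 + 1..l - 1. 1 / t ^ u) \<ge> 0"
      using \<open>A > 0\<close> t G_nonneg by (intro mult_nonneg_nonneg sum_nonneg) auto
    ultimately show "\<bar>(delta_right ^^ l) (heat_G t) (int n)\<bar> \<le>
      A / t powr (real l / 2) *
        (\<Sum>u = 0..l div 2. ((real n + 1 / 2)\<^sup>2 / t) powr (real l / 2 - real u)
            * heat_G t (int n + int l - 2 * int u))
      + A * heat_G t (int n) * (\<Sum>u = l div 2 + 1..l - 1. 1 / t ^ u)"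
      unfolding a_def by linarith
  qed
qed

end
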